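(* Let $p,q$ be complex numbers. The generating function of the even-indexed $(p,q)$-Pell numbers is, as a formal power series in $z$, $$\sum_{n=0}^{\infty}P_{p,q,2n}z^n=\frac{2pz}{1-2(2p^2+q)z+q^2z^2}.$$
   Context: The $(p,q)$-Pell numbers are defined by $P_{p,q,0}=0$, $P_{p,q,1}=1$, and $P_{p,q,n}=2pP_{p,q,n-1}+qP_{p,q,n-2}$ for $n\ge 2$. *)

theory Defs
  imports Complex_Main "HOL-Computational_Algebra.Formal_Power_Series"
begin

fun pell :: "complex \<Rightarrow> complex \<Rightarrow> nat \<Rightarrow> complex" where
  "pell p q 0 = 0"
| "pell p q (Suc 0) = 1"
| "pell p q (Suc (Suc n)) = 2 * p * pell p q (Suc n) + q * pell p q n"

end

theory Submission
  imports Defs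
begin

text \<open>The even-indexed terms satisfy a second-order linear recurrence
  (\<open>pell_double_step\<close>), and the denominator is its characteristic polynomial reversed.
  Multiplying the series by the denominator therefore kills every coefficient from index 2 on,
  leaving the numerator.\<close>

text \<open>If a and b are the roots of x^2 = 2px + q, the new coefficients are a^2 + b^2 = 4p^2 +
  2q and a^2 b^2 = q^2. The proof only unfolds the recurrence.\<close>

lemma pell_double_step:
  "pell p q (Suc (Suc (Suc (Suc n)))) =
    2 * (2 * p\<^sup>2 + q) * pell p q (Suc (Suc n)) - q\<^sup>2 * pell p q n"
  by (simp add: algebra_simps power2_eq_square)

theorem proposition4:
  fixes p q :: complex
  shows "Abs_fps (\<lambda>n. pell p q (2 * n)) =
    fps_const (2 * p) * fps_X /
      (1 - fps_const (2 * (2 * p\<^sup>2 + q)) * fps_X + fps_const (q\<^sup>2) * fps_X\<^sup>2)"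
proof -
  define A where "A = Abs_fps (\<lambda>n. pell p q (2 * n))"
  define c where "c = 2 * (2 * p\<^sup>2 + q)"
  define D where "D = 1 - fps_const c * fps_X + fps_const (q\<^sup>2) * fps_X\<^sup>2"
  have "fps_nth D 0 = 1"
    by (simp add: D_def)
  then have D: "D \<noteq> 0"
    by auto
  \<comment> \<open>With the powers of \<open>fps_X\<close> on the left, coefficients of the product
    become index shifts of \<open>A\<close>.\<close>
  have expand: "A * D = A - fps_const c * (fps_X * A) + fps_const (q\<^sup>2) * (fps_X\<^sup>2 * A)"
    by (simp add: D_def algebra_simps)
  have "A * D = fps_const (2 * p) * fps_X"
  proof (rule fps_ext)
    fix n
    consider "n = 0" | "n = 1" | m where "n = Suc (Suc m)"
      by (metis One_nat_def not0_implies_Suc)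
    then show "fps_nth (A * D) n = fps_nth (fps_const (2 * p) * fps_X) n"
    proof cases
      case 3
      then show ?thesis
        \<comment> \<open>The recurrence at \<open>2 * m\<close> is the vanishing of coefficient m +
          2; \<open>pell.simps\<close> is removed so that its terms stay folded.\<close>
        using pell_double_step[of p q "2 * m"]
        unfolding expand by (simp add: A_def c_def fps_X_power_mult_nth del: pell.simps)
    \<comment> \<open>The initial values give coefficients 0 and \<open>pell p q 2\<close> =
      2p.\<close>
    qed (unfold expand, simp_all add: A_def fps_X_power_mult_nth numeral_2_eq_2)
  qed
  then have "A = fps_const (2 * p) * fps_X / D"
    using D by (metis nonzero_mult_div_cancel_right)
  then show ?thesis
    by (simp add: A_def D_def c_def)
qed

end
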